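(* Let $v:R\to M$ be a strong m-valuation on a commutative semiring $R$. Assume that there exists a tangible supervaluation $\varphi:R\to U$ covering $v$. Then for any polynomial $f\in R[\lambda]=R[\lambda_1,\dots,\lambda_n]$, $$v(Z(f))\ \subset\ \mathrm{Corn}(\tilde v(f)).$$
   Context: All semirings are commutative with $0$ and $1$. A semiring $M$ is bipotent if $a+b\in\{a,b\}$ for all $a,b\in M$; it is totally ordered by $a\le b\iff a+b=b$. An m-valuation on $R$ is a map $v:R\to M$ into a bipotent semiring $M\neq\{0\}$ with $v(0)=0$, $v(1)=1$, $v(xy)=v(x)v(y)$, $v(x+y)\le v(x)+v(y)=\max(v(x),v(y))$. It is strong if $v(a+b)=\max(v(a),v(b))$ whenever $v(a)\neq v(b)$. A supertropical semiring is a semiring $U$ such that, with $e=e_U:=1+1$: (1) $1+1=1+1+1+1$; (2) $a+a=b+b$ implies $a+b=a+a$; (3) $a+a\ne b+b$ implies $a+b\in\{a,b\}$. Then $eU$ is a bipotent semiring with unit element $e$; $\mathcal T(U):=U\setminus eU$. A supervaluation on $R$ is a map $\varphi:R\to U$ into a supertropical semiring with $\varphi(0)=0$, $\varphi(1)=1$, $\varphi(ab)=\varphi(a)\varphi(b)$ and $e\varphi(a+b)\le e\varphi(a)+e\varphi(b)$. It covers $v$ if $eU=M$ and $e\varphi(a)=v(a)$ for all $a$; it is tangible if $\varphi(R)\subset\mathcal T(U)\cup\{0\}$. For $f=\sum_i c_i\lambda^i\in R[\lambda]$ ($i\in\mathbb N_0^n$ multi-indices, $\lambda^i=\lambda_1^{i_1}\cdots\lambda_n^{i_n}$,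 finitely many $c_i\ne 0$, $n\ge 1$): $\tilde v(f)=\sum_i v(c_i)\lambda^i\in M[\lambda]$; $Z(f)=\{a\in R^n: f(a)=0\}$; $v(a)=(v(a_1),\dots,v(a_n))$ for $a\in R^n$. For $g=\sum_i d_i\lambda^i\in M[\lambda]$, the corner locus $\mathrm{Corn}(g)$ is the set of all $b\in M^n$ for which there exist two different multi-indices $j,k\in\mathbb N_0^n$ with $d_jb^j=d_kb^k\ge d_ib^i$ for all $i\ne j,k$. *)

theory Defs
  imports "HOL-Algebra.Ring"
begin

locale csemiring = semiring R + comm_monoid R for R (structure)

definition semiring_le :: "('a, 'b) ring_scheme \<Rightarrow> 'a \<Rightarrow> 'a \<Rightarrow> bool" (infix \<open>\<preceq>\<index>\<close> 50)
  where "x \<preceq>\<^bsub>M\<^esub> y \<longleftrightarrow> x \<oplus>\<^bsub>M\<^esub> y = y"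

locale bipotent_semiring = csemiring M for M (structure) +
  assumes bipotent: "\<lbrakk>x \<in> carrier M; y \<in> carrier M\<rbrakk> \<Longrightarrow> x \<oplus> y \<in> {x, y}"

text \<open>In a bipotent semiring the sum of two elements is their maximum with respect to
  \<open>\<preceq>\<close>, so sums of values are used below in place of maxima.\<close>

locale m_valuation = R: csemiring R + M: bipotent_semiring M
  for R (structure) and M (structure) +
  fixes v
  assumes M_nontrivial: "carrier M \<noteq> {\<zero>\<^bsub>M\<^esub>}"
    and v_closed: "v \<in> carrier R \<rightarrow> carrier M"
    and v_zero: "v \<zero>\<^bsub>R\<^esub> = \<zero>\<^bsub>M\<^esub>"
    and v_one: "v \<one>\<^bsub>R\<^esub> = \<one>\<^bsub>M\<^esub>"
    and v_mult: "\<lbrakk>x \<in> carrier R; y \<in> carrier R\<rbrakk> \<Longrightarrow> v (x \<otimes>\<^bsub>R\<^esub> y) = v x \<otimes>\<^bsub>M\<^esub> v y"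
    and v_add: "\<lbrakk>x \<in> carrier R; y \<in> carrier R\<rbrakk> \<Longrightarrow> v (x \<oplus>\<^bsub>R\<^esub> y) \<preceq>\<^bsub>M\<^esub> v x \<oplus>\<^bsub>M\<^esub> v y"

locale strong_m_valuation = m_valuation +
  assumes strong: "\<lbrakk>x \<in> carrier R; y \<in> carrier R; v x \<noteq> v y\<rbrakk>
    \<Longrightarrow> v (x \<oplus>\<^bsub>R\<^esub> y) = v x \<oplus>\<^bsub>M\<^esub> v y"

definition ghost_unit :: "('a, 'b) ring_scheme \<Rightarrow> 'a" (\<open>\<^bold>e\<index>\<close>)
  where "\<^bold>e\<^bsub>U\<^esub> = \<one>\<^bsub>U\<^esub> \<oplus>\<^bsub>U\<^esub> \<one>\<^bsub>U\<^esub>"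

locale supertropical_semiring = csemiring U for U (structure) +
  assumes four_ones: "\<one> \<oplus> \<one> = \<one> \<oplus> \<one> \<oplus> \<one> \<oplus> \<one>"
    and add_eq_ghost: "\<lbrakk>a \<in> carrier U; b \<in> carrier U; a \<oplus> a = b \<oplus> b\<rbrakk> \<Longrightarrow> a \<oplus> b = a \<oplus> a"
    and add_neq_ghost: "\<lbrakk>a \<in> carrier U; b \<in> carrier U; a \<oplus> a \<noteq> b \<oplus> b\<rbrakk> \<Longrightarrow> a \<oplus> b \<in> {a, b}"

definition ghosts :: "('a, 'b) ring_scheme \<Rightarrow> 'a set"
  where "ghosts U = (\<lambda>a. \<^bold>e\<^bsub>U\<^esub> \<otimes>\<^bsub>U\<^esub> a) ` carrier U"

definition ghost_semiring :: "'a ring \<Rightarrow> 'a ring"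
  where "ghost_semiring U = U\<lparr>carrier := ghosts U, one := \<^bold>e\<^bsub>U\<^esub>\<rparr>"

definition tangibles :: "('a, 'b) ring_scheme \<Rightarrow> 'a set"
  where "tangibles U = carrier U - ghosts U"

text \<open>Equality of semirings: the operations are total functions on the underlying type, but only
  their values on the carrier are relevant.\<close>

definition same_semiring :: "'a ring \<Rightarrow> 'a ring \<Rightarrow> bool"
  where "same_semiring A B \<longleftrightarrow>
    carrier A = carrier B \<and> \<zero>\<^bsub>A\<^esub> = \<zero>\<^bsub>B\<^esub> \<and> \<one>\<^bsub>A\<^esub> = \<one>\<^bsub>B\<^esub> \<and>
    (\<forall>x\<in>carrier A. \<forall>y\<in>carrier A. x \<oplus>\<^bsub>A\<^esub> y = x \<oplus>\<^bsub>B\<^esub> y \<and> x \<otimes>\<^bsub>A\<^esub> y = x \<otimes>\<^bsub>B\<^esub> y)"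

locale supervaluation = R: csemiring R + U: supertropical_semiring U
  for R (structure) and U :: "'u ring" (structure) +
  fixes \<phi>
  assumes phi_closed: "\<phi> \<in> carrier R \<rightarrow> carrier U"
    and phi_zero: "\<phi> \<zero>\<^bsub>R\<^esub> = \<zero>\<^bsub>U\<^esub>"
    and phi_one: "\<phi> \<one>\<^bsub>R\<^esub> = \<one>\<^bsub>U\<^esub>"
    and phi_mult: "\<lbrakk>a \<in> carrier R; b \<in> carrier R\<rbrakk> \<Longrightarrow> \<phi> (a \<otimes>\<^bsub>R\<^esub> b) = \<phi> a \<otimes>\<^bsub>U\<^esub> \<phi> b"
    and phi_add: "\<lbrakk>a \<in> carrier R; b \<in> carrier R\<rbrakk> \<Longrightarrow>
      \<^bold>e\<^bsub>U\<^esub> \<otimes>\<^bsub>U\<^esub> \<phi> (a \<oplus>\<^bsub>R\<^esub> b)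
        \<preceq>\<^bsub>ghost_semiring U\<^esub> \<^bold>e\<^bsub>U\<^esub> \<otimes>\<^bsub>U\<^esub> \<phi> a \<oplus>\<^bsub>U\<^esub> \<^bold>e\<^bsub>U\<^esub> \<otimes>\<^bsub>U\<^esub> \<phi> b"

definition tangible_map :: "'r ring \<Rightarrow> 'u ring \<Rightarrow> ('r \<Rightarrow> 'u) \<Rightarrow> bool"
  where "tangible_map R U \<phi> \<longleftrightarrow> \<phi> ` carrier R \<subseteq> tangibles U \<union> {\<zero>\<^bsub>U\<^esub>}"

text \<open>The equation \<open>eU = M\<close> is literal, so \<open>U\<close> and \<open>M\<close> have the same element type.\<close>

definition covers :: "'r ring \<Rightarrow> 'u ring \<Rightarrow> ('r \<Rightarrow> 'u) \<Rightarrow> 'u ring \<Rightarrow> ('r \<Rightarrow> 'u) \<Rightarrow> bool"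
  where "covers R U \<phi> M v \<longleftrightarrow>
    same_semiring (ghost_semiring U) M \<and> (\<forall>a\<in>carrier R. \<^bold>e\<^bsub>U\<^esub> \<otimes>\<^bsub>U\<^esub> \<phi> a = v a)"

text \<open>The variables are indexed by a finite type \<open>'n\<close>, which has at least one element; a
  multi-index is a function \<open>'n \<Rightarrow> nat\<close>, and a polynomial is the family of its coefficients.\<close>

definition polynomials :: "'r ring \<Rightarrow> (('n::finite \<Rightarrow> nat) \<Rightarrow> 'r) set"
  where "polynomials R = {f. (\<forall>i. f i \<in> carrier R) \<and> finite {i. f i \<noteq> \<zero>\<^bsub>R\<^esub>}}"

definition points :: "'r ring \<Rightarrow> ('n::finite \<Rightarrow> 'r) set"
  where "points R = {a. \<forall>l. a l \<in> carrier R}"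

definition monomial_at :: "'r ring \<Rightarrow> ('n::finite \<Rightarrow> nat) \<Rightarrow> ('n \<Rightarrow> 'r) \<Rightarrow> 'r"
  where "monomial_at R i a = (\<Otimes>\<^bsub>R\<^esub>l\<in>UNIV. a l [^]\<^bsub>R\<^esub> i l)"

definition poly_at :: "'r ring \<Rightarrow> (('n::finite \<Rightarrow> nat) \<Rightarrow> 'r) \<Rightarrow> ('n \<Rightarrow> 'r) \<Rightarrow> 'r"
  where "poly_at R f a = (\<Oplus>\<^bsub>R\<^esub>i\<in>{i. f i \<noteq> \<zero>\<^bsub>R\<^esub>}. f i \<otimes>\<^bsub>R\<^esub> monomial_at R i a)"

definition zero_set :: "'r ring \<Rightarrow> (('n::finite \<Rightarrow> nat) \<Rightarrow> 'r) \<Rightarrow> ('n \<Rightarrow> 'r) set"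
  where "zero_set R f = {a \<in> points R. poly_at R f a = \<zero>\<^bsub>R\<^esub>}"

definition map_coeffs :: "('r \<Rightarrow> 'm) \<Rightarrow> (('n::finite \<Rightarrow> nat) \<Rightarrow> 'r) \<Rightarrow> ('n \<Rightarrow> nat) \<Rightarrow> 'm"
  where "map_coeffs v f = (\<lambda>i. v (f i))"

definition map_point :: "('r \<Rightarrow> 'm) \<Rightarrow> ('n::finite \<Rightarrow> 'r) \<Rightarrow> 'n \<Rightarrow> 'm"
  where "map_point v a = (\<lambda>l. v (a l))"

definition corner_locus :: "'m ring \<Rightarrow> (('n::finite \<Rightarrow> nat) \<Rightarrow> 'm) \<Rightarrow> ('n \<Rightarrow> 'm) set"
  where "corner_locus M g = {b \<in> points M. \<exists>j k. j \<noteq> k \<and>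
    g j \<otimes>\<^bsub>M\<^esub> monomial_at M j b = g k \<otimes>\<^bsub>M\<^esub> monomial_at M k b \<and>
    (\<forall>i. i \<noteq> j \<and> i \<noteq> k \<longrightarrow>
      g i \<otimes>\<^bsub>M\<^esub> monomial_at M i b \<preceq>\<^bsub>M\<^esub> g k \<otimes>\<^bsub>M\<^esub> monomial_at M k b)}"

end

theory Submission
  imports Defs
begin

text \<open>
  A root \<open>a\<close> of \<open>f\<close> makes the sum of the terms \<open>f i \<otimes> a^i\<close> zero. The term of largest value cannot
  be the only one of that value: under a strong valuation, a term that strictly exceeds all others
  passes its value on to the whole sum (\<open>v_finsum_dominant\<close>), so its value would be
  \<open>v \<zero> = \<zero>\<close>, the least element of \<open>M\<close>, and could not strictly exceed anything.
  Hence two distinct multi-indices attain the largest value. As \<open>v\<close> is multiplicative, the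
  value of \<open>f i \<otimes> a^i\<close> is the \<open>i\<close>-th term of the valuated polynomial at the valuated point
  (\<open>v_monomial_at\<close>), and so this point lies on the corner locus.

  The comparison runs over all multi-indices and not just over the support of \<open>f\<close>.
  There are at least two multi-indices, since there is at least one variable. So the argument
  needs no separate treatment of the zero polynomial or of a single monomial: terms outside the
  support have value \<open>\<zero>\<close>, and they compete with the others like any term.
\<close>

context bipotent_semiring
begin

lemma semiring_le_refl: "x \<in> carrier M \<Longrightarrow> x \<preceq> x"
  using bipotent[of x x] by (simp add: semiring_le_def)

lemma semiring_le_trans:
  assumes "x \<preceq> y" "y \<preceq> z" "x \<in> carrier M" "y \<in> carrier M" "z \<in> carrier M"
  shows "x \<preceq> z"
  using assms a_assoc[of x y z] by (simp add: semiring_le_def)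

lemma semiring_le_antisym:
  "\<lbrakk>x \<preceq> y; y \<preceq> x; x \<in> carrier M; y \<in> carrier M\<rbrakk> \<Longrightarrow> x = y"
  using a_comm[of x y] by (simp add: semiring_le_def)

lemma semiring_le_linear: "\<lbrakk>x \<in> carrier M; y \<in> carrier M\<rbrakk> \<Longrightarrow> x \<preceq> y \<or> y \<preceq> x"
  using bipotent[of x y] a_comm[of x y] by (auto simp: semiring_le_def)

lemma zero_semiring_le: "x \<in> carrier M \<Longrightarrow> \<zero> \<preceq> x"
  by (simp add: semiring_le_def)

lemma ex_greatest_value:
  assumes "finite S" "S \<noteq> {}" "\<And>i. i \<in> S \<Longrightarrow> w i \<in> carrier M"
  shows "\<exists>j\<in>S. \<forall>i\<in>S. w i \<preceq> w j"
  using assms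
proof (induction S rule: finite_ne_induct)
  case (singleton i)
  then show ?case by (simp add: semiring_le_refl)
next
  case (insert i S)
  then obtain j where j: "j \<in> S" "\<forall>k\<in>S. w k \<preceq> w j" by auto
  have closed: "\<And>k. k \<in> insert i S \<Longrightarrow> w k \<in> carrier M" by (rule insert.prems)
  show ?case
  proof (cases "w i \<preceq> w j")
    case True
    then show ?thesis using j by auto
  next
    case False
    then have "w j \<preceq> w i" using semiring_le_linear[of "w i" "w j"] closed j by auto
    then have "\<forall>k\<in>S. w k \<preceq> w i" using j closed by (blast intro: semiring_le_trans)
    then show ?thesis using closed by (auto simp: semiring_le_refl)
  qed
qed

end

context m_valuation
begin

lemma v_in_carrier: "x \<in> carrier R \<Longrightarrow> v x \<in> carrier M"
  using v_closed by auto

lemma v_nat_pow: "x \<in> carrier R \<Longrightarrow> v (x [^]\<^bsub>R\<^esub> (k::nat)) = v x [^]\<^bsub>M\<^esub> k"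
  by (induction k) (simp_all add: v_one v_mult)

lemma v_finprod:
  "\<lbrakk>finite A; t \<in> A \<rightarrow> carrier R\<rbrakk> \<Longrightarrow> v (finprod R t A) = finprod M (\<lambda>i. v (t i)) A"
  by (induction A rule: finite_induct)
    (simp_all add: v_one v_mult Pi_def v_in_carrier)

text \<open>As \<open>M\<close> is totally ordered, the maximum of finitely many elements strictly below \<open>m\<close> is
  again strictly below \<open>m\<close>, and the value of a sum does not exceed the maximum of the values. The
  assumption \<open>m \<noteq> \<zero>\<close> covers the empty sum.\<close>

lemma v_finsum_strictly_below:
  assumes "finite A" "t \<in> A \<rightarrow> carrier R" "m \<in> carrier M" "m \<noteq> \<zero>\<^bsub>M\<^esub>"
    and "\<And>i. i \<in> A \<Longrightarrow> v (t i) \<preceq>\<^bsub>M\<^esub> m \<and> v (t i) \<noteq> m"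
  shows "v (finsum R t A) \<preceq>\<^bsub>M\<^esub> m \<and> v (finsum R t A) \<noteq> m"
  using assms
proof (induction A rule: finite_induct)
  case empty
  then show ?case by (simp add: v_zero M.zero_semiring_le)
next
  case (insert i A)
  let ?s = "finsum R t A"
  have closed: "t i \<in> carrier R" "?s \<in> carrier R"
    using insert.prems by (auto intro: R.finsum_closed)
  have below: "v (t i) \<preceq>\<^bsub>M\<^esub> m" "v (t i) \<noteq> m" "v ?s \<preceq>\<^bsub>M\<^esub> m" "v ?s \<noteq> m"
    using insert by auto
  have "v (t i \<oplus>\<^bsub>R\<^esub> ?s) \<preceq>\<^bsub>M\<^esub> v (t i) \<or> v (t i \<oplus>\<^bsub>R\<^esub> ?s) \<preceq>\<^bsub>M\<^esub> v ?s"
    using v_add[OF closed] M.bipotent[of "v (t i)" "v ?s"] closed by (auto simp: v_in_carrier)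
  then have "v (t i \<oplus>\<^bsub>R\<^esub> ?s) \<preceq>\<^bsub>M\<^esub> m \<and> v (t i \<oplus>\<^bsub>R\<^esub> ?s) \<noteq> m"
    using below closed insert.prems(2)
    by (metis M.semiring_le_antisym M.semiring_le_trans R.add.m_closed v_in_carrier)
  moreover have "finsum R t (insert i A) = t i \<oplus>\<^bsub>R\<^esub> ?s"
    using insert by (auto intro: R.finsum_insert)
  ultimately show ?case by simp
qed

end

text \<open>The remaining terms sum to something of value still strictly below \<open>v (t j)\<close>, so
  strongness turns the inequality for the value of the full sum into an equality.\<close>

lemma (in strong_m_valuation) v_finsum_dominant:
  assumes "finite A" "t \<in> A \<rightarrow> carrier R" "j \<in> A" "v (t j) \<noteq> \<zero>\<^bsub>M\<^esub>"
    and "\<And>i. i \<in> A - {j} \<Longrightarrow> v (t i) \<preceq>\<^bsub>M\<^esub> v (t j) \<and> v (t i) \<noteq> v (t j)"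
  shows "v (finsum R t A) = v (t j)"
proof -
  let ?s = "finsum R t (A - {j})"
  have closed: "t j \<in> carrier R" "?s \<in> carrier R"
    using assms by (auto intro!: R.finsum_closed)
  have below: "v ?s \<preceq>\<^bsub>M\<^esub> v (t j) \<and> v ?s \<noteq> v (t j)"
    by (rule v_finsum_strictly_below) (use assms closed in \<open>auto simp: v_in_carrier\<close>)
  have "finsum R t (insert j (A - {j})) = t j \<oplus>\<^bsub>R\<^esub> ?s"
    using assms by (intro R.finsum_insert) auto
  then have "finsum R t A = ?s \<oplus>\<^bsub>R\<^esub> t j"
    using assms closed by (simp add: insert_absorb R.a_comm)
  then show ?thesis
    using strong[of ?s "t j"] below closed by (simp add: semiring_le_def)
qed

lemma monomial_at_closed:
  fixes S :: "'s ring" and a :: "'n::finite \<Rightarrow> 's"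
  assumes "csemiring S" "a \<in> points S"
  shows "monomial_at S i a \<in> carrier S"
proof -
  interpret S: csemiring S by fact
  show ?thesis using assms(2) by (auto simp: monomial_at_def points_def intro!: S.finprod_closed)
qed

lemma v_monomial_at:
  fixes R :: "'r ring" and M :: "'m ring" and a :: "'n::finite \<Rightarrow> 'r"
  assumes "m_valuation R M v" "a \<in> points R"
  shows "v (monomial_at R i a) = monomial_at M i (map_point v a)"
proof -
  interpret m_valuation R M v by fact
  show ?thesis using assms(2) unfolding monomial_at_def map_point_def points_def
    by (subst v_finprod) (auto simp: v_nat_pow)
qed

lemma ex_other_multi_index: "\<exists>k :: 'n \<Rightarrow> nat. k \<noteq> j"
  by (rule exI[of _ "\<lambda>l. Suc (j l)"]) (auto simp: fun_eq_iff)

theorem corollary9p13: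
  fixes R :: "'r ring" and M :: "'m ring" and v :: "'r \<Rightarrow> 'm"
    and f :: "('n::finite \<Rightarrow> nat) \<Rightarrow> 'r"
  assumes "strong_m_valuation R M v"
    and "\<exists>(U :: 'm ring) \<phi>. supervaluation R U \<phi> \<and> tangible_map R U \<phi> \<and> covers R U \<phi> M v"
    and "f \<in> polynomials R"
  shows "map_point v ` zero_set R f \<subseteq> corner_locus M (map_coeffs v f)"
proof (rule image_subsetI)
  fix a assume "a \<in> zero_set R f"
  then have a: "a \<in> points R" and root: "poly_at R f a = \<zero>\<^bsub>R\<^esub>"
    by (auto simp: zero_set_def)
  interpret strong_m_valuation R M v by fact
  define t where "t = (\<lambda>i. f i \<otimes>\<^bsub>R\<^esub> monomial_at R i a)"
  define A where "A = {i. f i \<noteq> \<zero>\<^bsub>R\<^esub>}"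
  have fin: "finite A" and f: "\<And>i. f i \<in> carrier R"
    using assms(3) by (auto simp: polynomials_def A_def)
  have mon: "\<And>i. monomial_at R i a \<in> carrier R"
    by (rule monomial_at_closed[OF R.csemiring_axioms a])
  have t: "\<And>i. t i \<in> carrier R" using f mon by (simp add: t_def)
  have vt: "\<And>i. v (t i) \<in> carrier M" using t by (rule v_in_carrier)
  have outside: "v (t i) = \<zero>\<^bsub>M\<^esub>" if "i \<notin> A" for i
    using that mon by (simp add: A_def t_def v_zero)
  have value_t: "v (t i) = map_coeffs v f i \<otimes>\<^bsub>M\<^esub> monomial_at M i (map_point v a)" for i
    using f mon by (simp add: t_def v_mult map_coeffs_def v_monomial_at[OF m_valuation_axioms a])
  \<comment> \<open>An arbitrary index is added to the support so that a greatest value exists even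
    when \<open>f\<close> is zero.\<close>
  obtain j where "\<forall>i\<in>insert undefined A. v (t i) \<preceq>\<^bsub>M\<^esub> v (t j)"
    using M.ex_greatest_value[of "insert undefined A" "\<lambda>i. v (t i)"] fin vt by auto
  then have greatest: "v (t i) \<preceq>\<^bsub>M\<^esub> v (t j)" for i
    using outside[of i] M.zero_semiring_le[OF vt[of j]] by (cases "i \<in> A") auto
  have "\<exists>k. k \<noteq> j \<and> v (t k) = v (t j)"
  proof (rule ccontr)
    assume "\<not> ?thesis"
    then have strict: "\<And>i. i \<noteq> j \<Longrightarrow> v (t i) \<noteq> v (t j)" by blast
    obtain k where "k \<noteq> j" using ex_other_multi_index by blast
    then have nonzero: "v (t j) \<noteq> \<zero>\<^bsub>M\<^esub>"
      using strict greatest[of k] M.zero_semiring_le vt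
      by (metis M.semiring_le_antisym M.zero_closed)
    then have "v (finsum R t A) = v (t j)"
      using fin t outside strict greatest by (intro v_finsum_dominant) auto
    moreover have "finsum R t A = \<zero>\<^bsub>R\<^esub>"
      using root by (simp add: poly_at_def A_def t_def)
    ultimately show False using nonzero by (simp add: v_zero)
  qed
  then obtain k where "k \<noteq> j" "v (t k) = v (t j)" by blast
  moreover have "map_point v a \<in> points M"
    using a by (simp add: points_def map_point_def v_in_carrier)
  ultimately show "map_point v a \<in> corner_locus M (map_coeffs v f)"
    using greatest unfolding corner_locus_def value_t by auto
qed

end
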